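(* (Generalized Law of Total Covariance) Let $k\ge 1$ be an integer, let $\mathbf{Y}=[Y_1,Y_2]^{\mathbf{T}}$ be a random vector with real components and let $X_1,\ldots,X_k$ be real random variables such that $\mathbf{Y},X_1,\ldots,X_k$ have a joint distribution (are defined on a common probability space). Assume that all the expectations and covariances (conditional and unconditional) appearing below exist and are finite. Put $\mathbf{X}_i=[X_1,\ldots,X_i]^{\mathbf{T}}$ for $i=1,\ldots,k$. Then $$ \begin{aligned} Cov(Y_1,Y_2) &=Cov_{X_1}\Big(E_{X_2|\mathbf{X}_1}\big[\cdots\big[E_{\mathbf{Y}|\mathbf{X}_k}(Y_1)\big]\cdots\big],\;E_{X_2|\mathbf{X}_1}\big[\cdots\big[E_{\mathbf{Y}|\mathbf{X}_k}(Y_2)\big]\cdots\big]\Big)\\ &\quad+E_{X_1}\Big[Cov_{X_2|\mathbf{X}_1}\Big(E_{X_3|\mathbf{X}_2}\big[\cdots\big[E_{\mathbf{Y}|\mathbf{X}_k}(Y_1)\big]\cdots\big],\;E_{X_3|\mathbf{X}_2}\big[\cdots\big[E_{\mathbf{Y}|\mathbf{X}_k}(Y_2)\big]\cdots\big]\Big)\Big]\\ &\quad\;\;\vdots\\ &\quad+E_{X_1}\Big[E_{X_2|\mathbf{X}_1}\Big[E_{X_3|\mathbf{X}_2}\Big[\cdots\Big[Cov_{\mathbf{Y}|\mathbf{X}_k}(Y_1,Y_2)\Big]\cdots\Big]\Big]\Big]. \end{aligned} $$ The sum has $k+1$ terms. For $i=1,\ldots,k$ the $i$-th term is $$E_{X_1}\Big[E_{X_2|\mathbf{X}_1}\Big[\cdots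 E_{X_{i-1}|\mathbf{X}_{i-2}}\Big[Cov_{X_i|\mathbf{X}_{i-1}}\big(M_i^{(1)},M_i^{(2)}\big)\Big]\cdots\Big]\Big],$$ where $M_i^{(j)}=E_{X_{i+1}|\mathbf{X}_i}\big[\cdots\big[E_{X_k|\mathbf{X}_{k-1}}\big[E_{\mathbf{Y}|\mathbf{X}_k}(Y_j)\big]\big]\cdots\big]$ for $j=1,2$ (so $M_k^{(j)}=E_{\mathbf{Y}|\mathbf{X}_k}(Y_j)$), and for $i=1$ the term is $Cov_{X_1}(M_1^{(1)},M_1^{(2)})$. The $(k+1)$-st term is $E_{X_1}\big[E_{X_2|\mathbf{X}_1}\big[\cdots E_{X_k|\mathbf{X}_{k-1}}\big[Cov_{\mathbf{Y}|\mathbf{X}_k}(Y_1,Y_2)\big]\cdots\big]\big]$.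
   Context: $Cov(Y_1,Y_2)=E\big([Y_1-E(Y_1)][Y_2-E(Y_2)]\big)=E(Y_1Y_2)-E(Y_1)E(Y_2)$. Subscripts on operators indicate the distribution with respect to which they are taken. $E_{X_1}$ and $Cov_{X_1}$ are the expectation and covariance, with respect to the distribution of $X_1$, of functions of $X_1$. $E_{X_i|\mathbf{X}_{i-1}}[g(X_1,\ldots,X_i)]$ is the conditional expectation of $g(X_1,\ldots,X_i)$ given $X_1,\ldots,X_{i-1}$ (a function of $X_1,\ldots,X_{i-1}$), and $E_{\mathbf{Y}|\mathbf{X}_k}(\cdot)$ is the conditional expectation of a function of $\mathbf{Y}$ given $X_1,\ldots,X_k$. Conditional covariances are covariances computed under the corresponding conditional distribution: $Cov_{X_i|\mathbf{X}_{i-1}}(A,B)=E_{X_i|\mathbf{X}_{i-1}}[AB]-E_{X_i|\mathbf{X}_{i-1}}[A]\,E_{X_i|\mathbf{X}_{i-1}}[B]$ for functions $A,B$ of $X_1,\ldots,X_i$, and $Cov_{\mathbf{Y}|\mathbf{X}_k}(Y_1,Y_2)=E_{\mathbf{Y}|\mathbf{X}_k}(Y_1Y_2)-E_{\mathbf{Y}|\mathbf{X}_k}(Y_1)E_{\mathbf{Y}|\mathbf{X}_k}(Y_2)$. *)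

theory Defs
  imports "HOL-Probability.Probability"
begin

section \<open>Covariance and conditional covariance\<close>

definition cov :: "'a measure \<Rightarrow> ('a \<Rightarrow> real) \<Rightarrow> ('a \<Rightarrow> real) \<Rightarrow> real" where
  "cov N A B = (\<integral>\<omega>. (A \<omega> - (\<integral>x. A x \<partial>N)) * (B \<omega> - (\<integral>x. B x \<partial>N)) \<partial>N)"

definition cov_exists :: "'a measure \<Rightarrow> ('a \<Rightarrow> real) \<Rightarrow> ('a \<Rightarrow> real) \<Rightarrow> bool" where
  "cov_exists N A B \<longleftrightarrow>
     integrable N A \<and> integrable N B \<and> integrable N (\<lambda>\<omega>. A \<omega> * B \<omega>)"

lemma cov_eq:
  assumes "prob_space N" "cov_exists N A B"
  shows "cov N A B = (\<integral>\<omega>. A \<omega> * B \<omega> \<partial>N) - (\<integral>\<omega>. A \<omega> \<partial>N) * (\<integral>\<omega>. B \<omega> \<partial>N)"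
proof -
  interpret prob_space N by fact
  define a b where "a = (\<integral>\<omega>. A \<omega> \<partial>N)" and "b = (\<integral>\<omega>. B \<omega> \<partial>N)"
  have int: "integrable N A" "integrable N B" "integrable N (\<lambda>\<omega>. A \<omega> * B \<omega>)"
    using assms(2) by (auto simp: cov_exists_def)
  have "cov N A B = (\<integral>\<omega>. A \<omega> * B \<omega> - b * A \<omega> - a * B \<omega> + a * b \<partial>N)"
    unfolding cov_def a_def[symmetric] b_def[symmetric] by (simp add: algebra_simps)
  also have "\<dots> = (\<integral>\<omega>. A \<omega> * B \<omega> \<partial>N) - b * a - a * b + a * b"
    using int by (simp add: a_def b_def prob_space)
  finally show ?thesis by (simp add: a_def b_def)
qed

text \<open>
  \<^const>\<open>real_cond_exp\<close> of \<open>f\<close> is the conditional expectation of the positive part of \<open>f\<close> minus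
  that of its negative part, so it is meaningful as soon as the conditional expectation of the
  absolute value of \<open>f\<close> is almost surely finite; \<open>f\<close> itself need not be integrable.
\<close>

definition cond_exp_exists :: "'a measure \<Rightarrow> 'a measure \<Rightarrow> ('a \<Rightarrow> real) \<Rightarrow> bool" where
  "cond_exp_exists M F f \<longleftrightarrow>
     f \<in> borel_measurable M \<and>
     (AE \<omega> in M. nn_cond_exp M F (\<lambda>\<omega>. ennreal \<bar>f \<omega>\<bar>) \<omega> < \<infinity>)"

definition cond_cov :: "'a measure \<Rightarrow> 'a measure \<Rightarrow> ('a \<Rightarrow> real) \<Rightarrow> ('a \<Rightarrow> real) \<Rightarrow> 'a \<Rightarrow> real" where
  "cond_cov M F A B =
     (\<lambda>\<omega>. real_cond_exp M F (\<lambda>\<omega>. A \<omega> * B \<omega>) \<omega>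
          - real_cond_exp M F A \<omega> * real_cond_exp M F B \<omega>)"

definition cond_cov_exists ::
  "'a measure \<Rightarrow> 'a measure \<Rightarrow> ('a \<Rightarrow> real) \<Rightarrow> ('a \<Rightarrow> real) \<Rightarrow> bool" where
  "cond_cov_exists M F A B \<longleftrightarrow>
     cond_exp_exists M F A \<and> cond_exp_exists M F B \<and> cond_exp_exists M F (\<lambda>\<omega>. A \<omega> * B \<omega>)"


section \<open>Conditioning on initial segments of a sequence of random variables\<close>

text \<open>The \<open>\<sigma>\<close>-algebra on the sample space generated by the random vector \<open>(X 1, \<dots>, X i)\<close>;
  conditioning on that vector means conditioning on this \<open>\<sigma>\<close>-algebra.\<close>

definition sigma_upto :: "'a measure \<Rightarrow> (nat \<Rightarrow> 'a \<Rightarrow> real) \<Rightarrow> nat \<Rightarrow> 'a measure" where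
  "sigma_upto M X i =
     vimage_algebra (space M) (\<lambda>\<omega>. \<lambda>j\<in>{1..i}. X j \<omega>) (\<Pi>\<^sub>M j\<in>{1..i}. borel)"

text \<open>Functions of \<open>X 1, \<dots>, X i\<close> are represented as random variables measurable with respect to
  \<^term>\<open>sigma_upto M X i\<close>. Accordingly, the distribution of \<open>(X 1, \<dots>, X i)\<close> is represented by the
  restriction of the probability to that \<open>\<sigma>\<close>-algebra; see \<open>integral_law_upto_1\<close> and
  \<open>integrable_law_upto_1\<close> below for the comparison with \<^const>\<open>distr\<close>.\<close>

definition law_upto :: "'a measure \<Rightarrow> (nat \<Rightarrow> 'a \<Rightarrow> real) \<Rightarrow> nat \<Rightarrow> 'a measure" where
  "law_upto M X i = restr_to_subalg M (sigma_upto M X i)"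

lemma subalgebra_sigma_upto:
  assumes "\<And>j. j \<in> {1..i} \<Longrightarrow> X j \<in> borel_measurable M"
  shows "subalgebra M (sigma_upto M X i)"
proof -
  have "(\<lambda>\<omega>. \<lambda>j\<in>{1..i}. X j \<omega>) \<in> M \<rightarrow>\<^sub>M (\<Pi>\<^sub>M j\<in>{1..i}. borel)"
    using assms by (intro measurable_restrict) auto
  then show ?thesis
    unfolding subalgebra_def sigma_upto_def
    by (auto simp: sets_vimage_algebra2 measurable_space intro: measurable_sets
        dest!: subsetD[OF sets_image_in_sets, rotated -1])
qed

lemma measurable_sigma_upto:
  assumes "j \<in> {1..i}"
  shows "X j \<in> borel_measurable (sigma_upto M X i)"
proof -
  let ?V = "\<lambda>\<omega>. \<lambda>j\<in>{1..i}. X j \<omega>"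
  have "?V \<in> sigma_upto M X i \<rightarrow>\<^sub>M (\<Pi>\<^sub>M j\<in>{1..i}. borel)"
    unfolding sigma_upto_def by (rule measurable_vimage_algebra1) (auto simp: space_PiM)
  then have "(\<lambda>\<omega>. ?V \<omega> j) \<in> borel_measurable (sigma_upto M X i)"
    using assms by (rule measurable_compose[OF _ measurable_component_singleton])
  then show ?thesis using assms by simp
qed

lemma
  fixes g :: "real \<Rightarrow> real"
  assumes X: "X 1 \<in> borel_measurable M" and g [measurable]: "g \<in> borel_measurable borel"
  shows integral_law_upto_1:
      "(\<integral>\<omega>. g (X 1 \<omega>) \<partial>law_upto M X 1) = (\<integral>x. g x \<partial>distr M borel (X 1))" (is ?A)
    and integrable_law_upto_1:
      "integrable (law_upto M X 1) (\<lambda>\<omega>. g (X 1 \<omega>)) \<longleftrightarrow> integrable (distr M borel (X 1)) g" (is ?B)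
proof -
  have sub: "subalgebra M (sigma_upto M X 1)"
    using X by (intro subalgebra_sigma_upto) auto
  have m: "(\<lambda>\<omega>. g (X 1 \<omega>)) \<in> borel_measurable (sigma_upto M X 1)"
    using measurable_sigma_upto[of 1 1 X M] by simp
  show ?A
    using integral_subalgebra2[OF sub m] integral_distr[OF X g] by (simp add: law_upto_def)
  show ?B
    using integrable_in_subalg[OF sub m] integrable_from_subalg[OF sub]
      integrable_distr_eq[OF X g]
    by (auto simp: law_upto_def)
qed

text \<open>The iterated conditional expectation
  \<open>E[E[\<dots> E[Z | X 1, \<dots>, X (b - 1)] \<dots> | X 1, \<dots>, X (a + 1)] | X 1, \<dots>, X a]\<close>,
  which is \<open>Z\<close> itself if \<open>b \<le> a\<close>.\<close>

definition iter_cond_exp ::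
  "'a measure \<Rightarrow> (nat \<Rightarrow> 'a \<Rightarrow> real) \<Rightarrow> nat \<Rightarrow> nat \<Rightarrow> ('a \<Rightarrow> real) \<Rightarrow> 'a \<Rightarrow> real" where
  "iter_cond_exp M X a b Z = foldr (\<lambda>m. real_cond_exp M (sigma_upto M X m)) [a..<b] Z"

definition iter_cond_exp_exists ::
  "'a measure \<Rightarrow> (nat \<Rightarrow> 'a \<Rightarrow> real) \<Rightarrow> nat \<Rightarrow> nat \<Rightarrow> ('a \<Rightarrow> real) \<Rightarrow> bool" where
  "iter_cond_exp_exists M X a b Z \<longleftrightarrow>
     (\<forall>m\<in>{a..<b}. cond_exp_exists M (sigma_upto M X m) (iter_cond_exp M X (Suc m) b Z))"

text \<open>The expectation with respect to the distribution of \<open>X 1\<close> of the above for \<open>a = 1\<close>.\<close>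

definition iter_exp ::
  "'a measure \<Rightarrow> (nat \<Rightarrow> 'a \<Rightarrow> real) \<Rightarrow> nat \<Rightarrow> ('a \<Rightarrow> real) \<Rightarrow> real" where
  "iter_exp M X b Z = (\<integral>\<omega>. iter_cond_exp M X 1 b Z \<omega> \<partial>law_upto M X 1)"

definition iter_exp_exists ::
  "'a measure \<Rightarrow> (nat \<Rightarrow> 'a \<Rightarrow> real) \<Rightarrow> nat \<Rightarrow> ('a \<Rightarrow> real) \<Rightarrow> bool" where
  "iter_exp_exists M X b Z \<longleftrightarrow>
     iter_cond_exp_exists M X 1 b Z \<and> integrable (law_upto M X 1) (iter_cond_exp M X 1 b Z)"

end

theory Submission
  imports Defs
begin

text \<open>
  Put \<open>F\<^sub>b\<close> for the \<open>\<sigma>\<close>-algebra of the first \<open>b\<close> variables and \<open>P\<^sub>b = M\<^sub>1 b * M\<^sub>2 b\<close>, so that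
  \<open>P\<close> at index \<open>k + 1\<close> is \<open>Y\<^sub>1 Y\<^sub>2\<close>. Since \<open>M\<^sub>j b\<close> is by construction the conditional
  expectation of \<open>M\<^sub>j (b + 1)\<close> given \<open>F\<^sub>b\<close>, the conditional covariance at level \<open>b\<close> is
  the defect \<open>D\<^sub>b = E[P\<^sub>b\<^sub>+\<^sub>1 | F\<^sub>b] - P\<^sub>b\<close>. Applying the iterated expectation to
  \<open>E[P\<^sub>b\<^sub>+\<^sub>1 | F\<^sub>b] = D\<^sub>b + P\<^sub>b\<close> and telescoping over \<open>b\<close> turns the sum of the expected
  conditional covariances into \<open>E(Y\<^sub>1 Y\<^sub>2) - E(P\<^sub>1)\<close>, and the covariance of \<open>M\<^sub>1 1\<close> and
  \<open>M\<^sub>2 1\<close> supplies \<open>E(P\<^sub>1) - E(Y\<^sub>1) E(Y\<^sub>2)\<close>.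

  The delicate point is that neither the intermediate \<open>P\<^sub>b\<close> nor the \<open>D\<^sub>b\<close> need be integrable:
  only the conditional expectations that are actually taken are known to be finite, one
  level at a time. Two things make the telescoping work nevertheless. Conditional expectation is
  additive on all functions whose absolute value has an almost surely finite conditional
  expectation (\<open>real_cond_exp_add_of_exists\<close>), and therefore so is the iterated expectation
  (\<open>iter_exp_add\<close>). And existence of the iterated expectation of \<open>P\<^sub>b\<close> is an outcome of the
  telescoping (\<open>iter_exp_telescope\<close>): it holds for \<open>P\<^sub>1\<close> and passes from \<open>P\<^sub>b\<close> to \<open>P\<^sub>b\<^sub>+\<^sub>1\<close>
  because it holds for \<open>D\<^sub>b\<close>. Of the products, only the two at the ends, \<open>P\<^sub>1\<close> and
  \<open>Y\<^sub>1 Y\<^sub>2\<close>, are known to be integrable.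
\<close>

section \<open>Conditional expectations of functions that need not be integrable\<close>

lemma cond_exp_exists_cong:
  assumes "sigma_finite_subalgebra M F" "cond_exp_exists M F f"
    and "AE x in M. g x = f x" and [measurable]: "g \<in> borel_measurable M"
  shows "cond_exp_exists M F g"
proof -
  interpret sigma_finite_subalgebra M F by fact
  have [measurable]: "f \<in> borel_measurable M"
    using assms(2) by (simp add: cond_exp_exists_def)
  have "AE x in M. nn_cond_exp M F (\<lambda>x. ennreal \<bar>g x\<bar>) x = nn_cond_exp M F (\<lambda>x. ennreal \<bar>f x\<bar>) x"
    using assms(3) by (intro nn_cond_exp_cong) auto
  then show ?thesis
    using assms(2) by (auto simp: cond_exp_exists_def)
qed

lemma cond_exp_exists_add:
  assumes "sigma_finite_subalgebra M F" "cond_exp_exists M F f" "cond_exp_exists M F g"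
  shows "cond_exp_exists M F (\<lambda>x. f x + g x)"
proof -
  interpret sigma_finite_subalgebra M F by fact
  have [measurable]: "f \<in> borel_measurable M" "g \<in> borel_measurable M"
    using assms(2,3) by (simp_all add: cond_exp_exists_def)
  have "AE x in M. nn_cond_exp M F (\<lambda>x. ennreal \<bar>f x + g x\<bar>) x
      \<le> nn_cond_exp M F (\<lambda>x. ennreal \<bar>f x\<bar> + ennreal \<bar>g x\<bar>) x"
    by (intro nn_cond_exp_mono)
       (auto simp: ennreal_plus[symmetric] simp del: ennreal_plus intro!: AE_I2 ennreal_leI)
  moreover have "AE x in M. nn_cond_exp M F (\<lambda>x. ennreal \<bar>f x\<bar>) x + nn_cond_exp M F (\<lambda>x. ennreal \<bar>g x\<bar>) x
      = nn_cond_exp M F (\<lambda>x. ennreal \<bar>f x\<bar> + ennreal \<bar>g x\<bar>) x"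
    by (intro nn_cond_exp_sum) auto
  moreover have "AE x in M. nn_cond_exp M F (\<lambda>x. ennreal \<bar>f x\<bar>) x < \<infinity>"
    "AE x in M. nn_cond_exp M F (\<lambda>x. ennreal \<bar>g x\<bar>) x < \<infinity>"
    using assms(2,3) by (simp_all add: cond_exp_exists_def)
  ultimately have "AE x in M. nn_cond_exp M F (\<lambda>x. ennreal \<bar>f x + g x\<bar>) x < \<infinity>"
  proof eventually_elim
    case (elim x)
    have "nn_cond_exp M F (\<lambda>x. ennreal \<bar>f x\<bar>) x + nn_cond_exp M F (\<lambda>x. ennreal \<bar>g x\<bar>) x < \<infinity>"
      using elim(3,4) by simp
    with elim(1,2) show ?case by simp
  qed
  then show ?thesis by (simp add: cond_exp_exists_def)
qed

lemma cond_exp_exists_parts_finite: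
  assumes "sigma_finite_subalgebra M F" "cond_exp_exists M F f"
  shows "AE x in M. nn_cond_exp M F (\<lambda>x. ennreal (f x)) x < \<infinity>"
    and "AE x in M. nn_cond_exp M F (\<lambda>x. ennreal (- f x)) x < \<infinity>"
proof -
  interpret sigma_finite_subalgebra M F by fact
  have [measurable]: "f \<in> borel_measurable M" and
    fin: "AE x in M. nn_cond_exp M F (\<lambda>x. ennreal \<bar>f x\<bar>) x < \<infinity>"
    using assms(2) by (simp_all add: cond_exp_exists_def)
  have "AE x in M. nn_cond_exp M F (\<lambda>x. ennreal (f x)) x \<le> nn_cond_exp M F (\<lambda>x. ennreal \<bar>f x\<bar>) x"
    by (intro nn_cond_exp_mono) (auto intro!: AE_I2 ennreal_leI)
  with fin show "AE x in M. nn_cond_exp M F (\<lambda>x. ennreal (f x)) x < \<infinity>"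
    by eventually_elim (rule le_less_trans)
  have "AE x in M. nn_cond_exp M F (\<lambda>x. ennreal (- f x)) x \<le> nn_cond_exp M F (\<lambda>x. ennreal \<bar>f x\<bar>) x"
    by (intro nn_cond_exp_mono) (auto intro!: AE_I2 ennreal_leI)
  with fin show "AE x in M. nn_cond_exp M F (\<lambda>x. ennreal (- f x)) x < \<infinity>"
    by eventually_elim (rule le_less_trans)
qed

text \<open>
  Conditioning both sides of \<open>(f + g)\<^sup>+ + f\<^sup>- + g\<^sup>- = (f + g)\<^sup>- + f\<^sup>+ + g\<^sup>+\<close> only involves
  nonnegative functions, for which additivity is unconditional; all six terms are
  almost surely finite, so the result can be rearranged in the reals.
\<close>

lemma real_cond_exp_add_of_exists:
  assumes "sigma_finite_subalgebra M F" "cond_exp_exists M F f" "cond_exp_exists M F g"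
  shows "AE x in M. real_cond_exp M F (\<lambda>x. f x + g x) x
    = real_cond_exp M F f x + real_cond_exp M F g x"
proof -
  interpret sigma_finite_subalgebra M F by fact
  have [measurable]: "f \<in> borel_measurable M" "g \<in> borel_measurable M"
    using assms(2,3) by (simp_all add: cond_exp_exists_def)
  define N where "N h = nn_cond_exp M F (\<lambda>x. ennreal (h x))" for h :: "'a \<Rightarrow> real"
  define s where "s = (\<lambda>x. f x + g x)"
  have [measurable]: "s \<in> borel_measurable M" by (simp add: s_def)
  have ex: "cond_exp_exists M F s"
    unfolding s_def using assms by (rule cond_exp_exists_add)
  have sum3: "AE x in M. N u x + (N v x + N w x)
      = nn_cond_exp M F (\<lambda>x. ennreal (u x) + (ennreal (v x) + ennreal (w x))) x"
    if [measurable]: "u \<in> borel_measurable M" "v \<in> borel_measurable M" "w \<in> borel_measurable M"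
    for u v w :: "'a \<Rightarrow> real"
  proof -
    have "AE x in M. N v x + N w x = nn_cond_exp M F (\<lambda>x. ennreal (v x) + ennreal (w x)) x"
      unfolding N_def by (intro nn_cond_exp_sum) auto
    moreover have "AE x in M. N u x + nn_cond_exp M F (\<lambda>x. ennreal (v x) + ennreal (w x)) x
      = nn_cond_exp M F (\<lambda>x. ennreal (u x) + (ennreal (v x) + ennreal (w x))) x"
      unfolding N_def by (intro nn_cond_exp_sum) auto
    ultimately show ?thesis by eventually_elim simp
  qed
  have pos_part: "ennreal r = ennreal (max 0 r)" for r
    by (simp add: max_def ennreal_neg)
  have parts: "ennreal (s x) + (ennreal (- f x) + ennreal (- g x))
      = ennreal (- s x) + (ennreal (f x) + ennreal (g x))" for x
    unfolding s_def
    by (subst (1 2 3 4 5 6) pos_part) (simp add: ennreal_plus[symmetric] max_def del: ennreal_plus)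
  have "AE x in M. N s x + (N (\<lambda>x. - f x) x + N (\<lambda>x. - g x) x)
      = nn_cond_exp M F (\<lambda>x. ennreal (s x) + (ennreal (- f x) + ennreal (- g x))) x"
    by (intro sum3) auto
  moreover have "AE x in M. N (\<lambda>x. - s x) x + (N f x + N g x)
      = nn_cond_exp M F (\<lambda>x. ennreal (s x) + (ennreal (- f x) + ennreal (- g x))) x"
    unfolding parts by (intro sum3) auto
  moreover note assms(2,3)[THEN cond_exp_exists_parts_finite(1)[OF assms(1)]]
    assms(2,3)[THEN cond_exp_exists_parts_finite(2)[OF assms(1)]]
    ex[THEN cond_exp_exists_parts_finite(1)[OF assms(1)]]
    ex[THEN cond_exp_exists_parts_finite(2)[OF assms(1)]]
  ultimately have "AE x in M. real_cond_exp M F s x = real_cond_exp M F f x + real_cond_exp M F g x"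
  proof eventually_elim
    case (elim x)
    then have "N s x + (N (\<lambda>x. - f x) x + N (\<lambda>x. - g x) x)
        = N (\<lambda>x. - s x) x + (N f x + N g x)" by simp
    then have "enn2real (N s x + (N (\<lambda>x. - f x) x + N (\<lambda>x. - g x) x))
        = enn2real (N (\<lambda>x. - s x) x + (N f x + N g x))" by simp
    then have "enn2real (N s x) + (enn2real (N (\<lambda>x. - f x) x) + enn2real (N (\<lambda>x. - g x) x))
        = enn2real (N (\<lambda>x. - s x) x) + (enn2real (N f x) + enn2real (N g x))"
      using elim(3-8) by (simp add: enn2real_plus N_def)
    then show ?case
      by (simp add: real_cond_exp_def N_def)
  qed
  then show ?thesis by (simp add: s_def)
qed


section \<open>Iterated conditional expectations\<close>

lemma iter_cond_exp_ge [simp]: "b \<le> a \<Longrightarrow> iter_cond_exp M X a b Z = Z"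
  by (simp add: iter_cond_exp_def)

lemma iter_cond_exp_less:
  "a < b \<Longrightarrow> iter_cond_exp M X a b Z
    = real_cond_exp M (sigma_upto M X a) (iter_cond_exp M X (Suc a) b Z)"
  by (simp add: iter_cond_exp_def upt_conv_Cons)

lemma iter_cond_exp_Suc:
  "a \<le> b \<Longrightarrow> iter_cond_exp M X a (Suc b) Z
    = iter_cond_exp M X a b (real_cond_exp M (sigma_upto M X b) Z)"
  by (simp add: iter_cond_exp_def)

lemma borel_measurable_iter_cond_exp:
  "Z \<in> borel_measurable M \<Longrightarrow> iter_cond_exp M X a b Z \<in> borel_measurable M"
  by (cases "a < b") (simp_all add: iter_cond_exp_less)

lemma borel_measurable_iter_cond_exp_sigma_upto:
  "a < b \<Longrightarrow> iter_cond_exp M X a b Z \<in> borel_measurable (sigma_upto M X a)"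
  by (simp add: iter_cond_exp_less)

lemma iter_cond_exp_exists_Suc:
  assumes "a \<le> b"
  shows "iter_cond_exp_exists M X a (Suc b) Z \<longleftrightarrow>
    cond_exp_exists M (sigma_upto M X b) Z \<and>
    iter_cond_exp_exists M X a b (real_cond_exp M (sigma_upto M X b) Z)"
proof -
  have "{a..<Suc b} = insert b {a..<b}" using assms by auto
  then show ?thesis
    by (simp add: iter_cond_exp_exists_def iter_cond_exp_Suc)
qed

lemma iter_cond_exp_add:
  assumes "\<And>m. m \<in> {a..<b} \<Longrightarrow> sigma_finite_subalgebra M (sigma_upto M X m)"
    and "U \<in> borel_measurable M" "V \<in> borel_measurable M"
    and "iter_cond_exp_exists M X a b U" "iter_cond_exp_exists M X a b V"
  shows "iter_cond_exp_exists M X a b (\<lambda>x. U x + V x)"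
    and "AE x in M. iter_cond_exp M X a b (\<lambda>x. U x + V x) x
      = iter_cond_exp M X a b U x + iter_cond_exp M X a b V x"
proof -
  let ?I = "\<lambda>m. iter_cond_exp M X m b" and ?S = "\<lambda>x. U x + V x"
  have step: "cond_exp_exists M (sigma_upto M X m) (?I (Suc m) ?S) \<and>
      (AE x in M. ?I m ?S x = ?I m U x + ?I m V x)"
    if m: "m \<in> {a..<b}" and IH: "AE x in M. ?I (Suc m) ?S x = ?I (Suc m) U x + ?I (Suc m) V x" for m
  proof -
    let ?F = "sigma_upto M X m"
    interpret sigma_finite_subalgebra M ?F using m by (rule assms(1))
    have ex: "cond_exp_exists M ?F (?I (Suc m) U)" "cond_exp_exists M ?F (?I (Suc m) V)"
      using m assms(4,5) by (auto simp: iter_cond_exp_exists_def)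
    have [measurable]: "?I (Suc m) ?S \<in> borel_measurable M"
      "?I (Suc m) U \<in> borel_measurable M" "?I (Suc m) V \<in> borel_measurable M"
      using assms(2,3) by (auto intro!: borel_measurable_iter_cond_exp)
    have "cond_exp_exists M ?F (?I (Suc m) ?S)"
      using cond_exp_exists_cong[OF sigma_finite_subalgebra_axioms
          cond_exp_exists_add[OF sigma_finite_subalgebra_axioms ex] IH] by simp
    moreover have "AE x in M. real_cond_exp M ?F (?I (Suc m) ?S) x
        = real_cond_exp M ?F (\<lambda>x. ?I (Suc m) U x + ?I (Suc m) V x) x"
      by (intro real_cond_exp_cong IH) auto
    then have "AE x in M. ?I m ?S x = ?I m U x + ?I m V x"
      using real_cond_exp_add_of_exists[OF sigma_finite_subalgebra_axioms ex]
      by eventually_elim (use m in \<open>simp add: iter_cond_exp_less\<close>)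
    ultimately show ?thesis by simp
  qed
  have AE: "AE x in M. ?I m ?S x = ?I m U x + ?I m V x" if "a \<le> m" for m
    using that
  proof (induction "b - m" arbitrary: m)
    case 0
    then show ?case by simp
  next
    case (Suc d)
    then show ?case using step[of m] by simp
  qed
  show "AE x in M. ?I a ?S x = ?I a U x + ?I a V x"
    by (rule AE) simp
  show "iter_cond_exp_exists M X a b ?S"
    unfolding iter_cond_exp_exists_def using step AE by simp
qed

lemma integrable_iter_cond_exp:
  assumes "\<And>m. m \<in> {a..<b} \<Longrightarrow> sigma_finite_subalgebra M (sigma_upto M X m)"
    and "integrable M Z"
  shows "integrable M (iter_cond_exp M X a b Z)"
    and "(\<integral>x. iter_cond_exp M X a b Z x \<partial>M) = (\<integral>x. Z x \<partial>M)"
  using assms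
proof (induction "b - a" arbitrary: a)
  case 0
  { case 1 with 0 show ?case by simp
  next case 2 with 0 show ?case by simp }
next
  case (Suc d)
  have "integrable M (iter_cond_exp M X a b Z) \<and>
      (\<integral>x. iter_cond_exp M X a b Z x \<partial>M) = (\<integral>x. Z x \<partial>M)"
    if sub: "\<And>m. m \<in> {a..<b} \<Longrightarrow> sigma_finite_subalgebra M (sigma_upto M X m)"
  proof -
    have "a < b" using Suc.hyps by simp
    interpret sigma_finite_subalgebra M "sigma_upto M X a"
      using \<open>a < b\<close> by (intro sub) simp
    have "integrable M (iter_cond_exp M X (Suc a) b Z)"
      "(\<integral>x. iter_cond_exp M X (Suc a) b Z x \<partial>M) = (\<integral>x. Z x \<partial>M)"
      using Suc.hyps sub assms(2) by auto
    then show ?thesis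
      using \<open>a < b\<close> by (simp add: iter_cond_exp_less real_cond_exp_int)
  qed
  note * = this
  { case 1 then show ?case using * by blast
  next case 2 then show ?case using * by blast }
qed


section \<open>Iterated expectations and telescoping\<close>

text \<open>
  Equality almost everywhere with respect to the full probability descends to the law of
  \<open>X 1\<close> only for functions of \<open>X 1\<close>. For \<open>b \<le> 1\<close>, where no conditional expectation is
  taken and \<open>U\<close>, \<open>V\<close> are arbitrary, the equality holds everywhere instead.
\<close>

lemma iter_exp_add:
  assumes sub: "\<And>m. m \<in> {1..<b} \<Longrightarrow> sigma_finite_subalgebra M (sigma_upto M X m)"
    and "U \<in> borel_measurable M" "V \<in> borel_measurable M"
    and "iter_exp_exists M X b U" "iter_exp_exists M X b V"
  shows "iter_exp_exists M X b (\<lambda>x. U x + V x)"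
    and "iter_exp M X b (\<lambda>x. U x + V x) = iter_exp M X b U + iter_exp M X b V"
proof -
  let ?I = "iter_cond_exp M X 1 b" and ?S = "\<lambda>x. U x + V x" and ?L = "law_upto M X 1"
  have ex: "iter_cond_exp_exists M X 1 b U" "iter_cond_exp_exists M X 1 b V"
    and int: "integrable ?L (?I U)" "integrable ?L (?I V)"
    using assms(4,5) by (auto simp: iter_exp_exists_def)
  have "(AE x in ?L. ?I ?S x = ?I U x + ?I V x) \<and> ?I ?S \<in> borel_measurable ?L"
  proof (cases "1 < b")
    case True
    interpret sigma_finite_subalgebra M "sigma_upto M X 1"
      using True by (intro sub) simp
    have [measurable]: "?I Z \<in> borel_measurable (sigma_upto M X 1)" for Z
      using True by (rule borel_measurable_iter_cond_exp_sigma_upto)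
    have "AE x in ?L. ?I ?S x = ?I U x + ?I V x"
      unfolding law_upto_def
      by (rule AE_restr_to_subalg2[OF subalg iter_cond_exp_add(2)[OF sub assms(2,3) ex]]) measurable
    moreover have "?I ?S \<in> borel_measurable ?L"
      unfolding law_upto_def by (rule measurable_in_subalg[OF subalg]) measurable
    ultimately show ?thesis by simp
  next
    case False
    then show ?thesis using int by simp
  qed
  then have AE: "AE x in ?L. ?I ?S x = ?I U x + ?I V x"
    and [measurable]: "?I ?S \<in> borel_measurable ?L" by auto
  have [measurable]: "?I U \<in> borel_measurable ?L" "?I V \<in> borel_measurable ?L"
    using int by auto
  have sum_int: "integrable ?L (\<lambda>x. ?I U x + ?I V x)" using int by simp
  have "integrable ?L (?I ?S)"
    by (rule integrable_cong_AE[THEN iffD2, OF _ _ AE sum_int]) measurable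
  then show "iter_exp_exists M X b ?S"
    using iter_cond_exp_add(1)[OF sub assms(2,3) ex] by (simp add: iter_exp_exists_def)
  have "iter_exp M X b ?S = (\<integral>x. ?I U x + ?I V x \<partial>?L)"
    unfolding iter_exp_def by (rule integral_cong_AE[OF _ _ AE]) measurable
  then show "iter_exp M X b ?S = iter_exp M X b U + iter_exp M X b V"
    using int by (simp add: iter_exp_def)
qed

lemma integral_law_upto:
  fixes f :: "'a \<Rightarrow> real"
  assumes "subalgebra M (sigma_upto M X i)" "f \<in> borel_measurable (sigma_upto M X i)"
  shows "(\<integral>x. f x \<partial>law_upto M X i) = (\<integral>x. f x \<partial>M)"
  using integral_subalgebra2[OF assms] by (simp add: law_upto_def)

lemma iter_exp_eq_expectation:
  assumes sub: "\<And>m. m \<in> {1..<b} \<Longrightarrow> sigma_finite_subalgebra M (sigma_upto M X m)"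
    and "1 < b" "integrable M Z"
  shows "iter_exp M X b Z = (\<integral>x. Z x \<partial>M)"
proof -
  interpret sigma_finite_subalgebra M "sigma_upto M X 1"
    using \<open>1 < b\<close> by (intro sub) simp
  show ?thesis
    unfolding iter_exp_def
    using integral_law_upto[OF subalg borel_measurable_iter_cond_exp_sigma_upto[OF \<open>1 < b\<close>]]
      integrable_iter_cond_exp(2)[OF sub \<open>integrable M Z\<close>]
    by simp
qed

text \<open>
  The defects of a sequence \<open>P\<close> from being a martingale add up, in iterated expectation, to its
  total increase. That the iterated expectation of \<open>P b\<close> exists has to be carried along:
  it is what permits splitting \<open>E[P (b + 1) | F b]\<close> into the defect and \<open>P b\<close>.
\<close>

lemma iter_exp_telescope:
  fixes M :: "'a measure" and X P :: "nat \<Rightarrow> 'a \<Rightarrow> real"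
  defines "D \<equiv> \<lambda>i x. real_cond_exp M (sigma_upto M X (i - 1)) (P i) x - P (i - 1) x"
  assumes "1 \<le> n"
    and sub: "\<And>m. m \<in> {1..<n} \<Longrightarrow> sigma_finite_subalgebra M (sigma_upto M X m)"
    and meas: "\<And>i. i \<in> {1..n} \<Longrightarrow> P i \<in> borel_measurable M"
    and int: "integrable (law_upto M X 1) (P 1)"
    and ex: "\<And>i. i \<in> {2..n} \<Longrightarrow> cond_exp_exists M (sigma_upto M X (i - 1)) (P i)"
    and exD: "\<And>i. i \<in> {2..n} \<Longrightarrow> iter_exp_exists M X (i - 1) (D i)"
  shows "iter_exp_exists M X n (P n) \<and>
    iter_exp M X n (P n) = (\<integral>x. P 1 x \<partial>law_upto M X 1) + (\<Sum>i=2..n. iter_exp M X (i - 1) (D i))"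
  using \<open>1 \<le> n\<close> sub meas ex exD
proof (induction n rule: nat_induct_at_least)
  case base
  then show ?case
    using int by (simp add: iter_exp_exists_def iter_cond_exp_exists_def iter_exp_def)
next
  case (Suc b)
  let ?E = "real_cond_exp M (sigma_upto M X b) (P (Suc b))"
  have IH: "iter_exp_exists M X b (P b)"
    "iter_exp M X b (P b) = (\<integral>x. P 1 x \<partial>law_upto M X 1) + (\<Sum>i=2..b. iter_exp M X (i - 1) (D i))"
    using Suc.IH Suc.prems by auto
  have split: "?E = (\<lambda>x. D (Suc b) x + P b x)"
    by (simp add: D_def)
  have [measurable]: "P b \<in> borel_measurable M"
    using Suc by simp
  have mD: "D (Suc b) \<in> borel_measurable M"
    by (simp add: D_def)
  have eD: "iter_exp_exists M X b (D (Suc b))"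
    using Suc.prems(4)[of "Suc b"] Suc.hyps by simp
  have sub': "sigma_finite_subalgebra M (sigma_upto M X m)" if "m \<in> {1..<b}" for m
    using Suc.prems(1) that by simp
  have exE: "iter_exp_exists M X b ?E"
    unfolding split by (rule iter_exp_add(1)[OF sub' mD _ eD IH(1)]) auto
  have eqE: "iter_exp M X b ?E = iter_exp M X b (D (Suc b)) + iter_exp M X b (P b)"
    unfolding split by (rule iter_exp_add(2)[OF sub' mD _ eD IH(1)]) auto
  have "iter_exp_exists M X (Suc b) (P (Suc b))"
    using exE Suc.prems(3)[of "Suc b"] Suc.hyps
    by (simp add: iter_exp_exists_def iter_cond_exp_exists_Suc iter_cond_exp_Suc)
  moreover have "iter_exp M X (Suc b) (P (Suc b)) = iter_exp M X b ?E"
    using Suc.hyps by (simp add: iter_exp_def iter_cond_exp_Suc)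
  ultimately show ?case
    using eqE IH(2) Suc.hyps by simp
qed


section \<open>The law of total covariance\<close>

theorem theorem4:
  fixes M :: "'a measure" and Y1 Y2 :: "'a \<Rightarrow> real" and X :: "nat \<Rightarrow> 'a \<Rightarrow> real" and k :: nat
  defines "M1 \<equiv> \<lambda>i. iter_cond_exp M X i (k + 1) Y1"
    and "M2 \<equiv> \<lambda>i. iter_cond_exp M X i (k + 1) Y2"
    and "F \<equiv> sigma_upto M X"
  assumes "prob_space M"
    and "k \<ge> 1"
    and "Y1 \<in> borel_measurable M" and "Y2 \<in> borel_measurable M"
    and "\<And>i. i \<in> {1..k} \<Longrightarrow> X i \<in> borel_measurable M"
    and "cov_exists M Y1 Y2"
    and "iter_cond_exp_exists M X 1 (k + 1) Y1" and "iter_cond_exp_exists M X 1 (k + 1) Y2"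
    and "cov_exists (law_upto M X 1) (M1 1) (M2 1)"
    and "\<And>i. i \<in> {2..k} \<Longrightarrow> cond_cov_exists M (F (i - 1)) (M1 i) (M2 i)"
    and "\<And>i. i \<in> {2..k} \<Longrightarrow> iter_exp_exists M X (i - 1) (cond_cov M (F (i - 1)) (M1 i) (M2 i))"
    and "cond_cov_exists M (F k) Y1 Y2"
    and "iter_exp_exists M X k (cond_cov M (F k) Y1 Y2)"
  shows "cov M Y1 Y2 =
      cov (law_upto M X 1) (M1 1) (M2 1)
    + (\<Sum>i=2..k. iter_exp M X (i - 1) (cond_cov M (F (i - 1)) (M1 i) (M2 i)))
    + iter_exp M X k (cond_cov M (F k) Y1 Y2)"
proof -
  interpret prob_space M by fact
  have subalg: "subalgebra M (F m)" if "m \<in> {1..<k + 1}" for m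
    unfolding F_def using that assms(8) by (intro subalgebra_sigma_upto) auto
  have sub: "sigma_finite_subalgebra M (sigma_upto M X m)" if "m \<in> {1..<k + 1}" for m
    using subalg[OF that] unfolding F_def
    by (intro finite_measure_subalgebra_is_sigma_finite finite_measure_subalgebra.intro
        finite_measure_subalgebra_axioms.intro) unfold_locales
  have int: "integrable M Y1" "integrable M Y2" "integrable M (\<lambda>x. Y1 x * Y2 x)"
    using assms(9) by (auto simp: cov_exists_def)
  define P where "P i = (\<lambda>x. M1 i x * M2 i x)" for i
  define C where "C i = cond_cov M (F (i - 1)) (M1 i) (M2 i)" for i
  have last: "M1 (k + 1) = Y1" "M2 (k + 1) = Y2"
    by (simp_all add: M1_def M2_def)
  have [measurable]: "M1 i \<in> borel_measurable M" "M2 i \<in> borel_measurable M" for i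
    using assms(6,7) by (auto simp: M1_def M2_def intro: borel_measurable_iter_cond_exp)
  \<comment> \<open>The product of conditional means subtracted in \<open>C i\<close> is \<open>P (i - 1)\<close> on the nose,
    because one more conditioning step leads from \<open>M1 i\<close> to \<open>M1 (i - 1)\<close>.\<close>
  have C_eq: "C i = (\<lambda>x. real_cond_exp M (sigma_upto M X (i - 1)) (P i) x - P (i - 1) x)"
    if "i \<in> {2..k + 1}" for i
  proof -
    have "i - 1 < k + 1" "Suc (i - 1) = i" using that by auto
    then have "M1 (i - 1) = real_cond_exp M (F (i - 1)) (M1 i)"
      "M2 (i - 1) = real_cond_exp M (F (i - 1)) (M2 i)"
      unfolding M1_def M2_def F_def by (simp_all only: iter_cond_exp_less)
    then show ?thesis by (simp add: C_def cond_cov_def P_def F_def)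
  qed
  have C_exists: "cond_cov_exists M (F (i - 1)) (M1 i) (M2 i) \<and> iter_exp_exists M X (i - 1) (C i)"
    if "i \<in> {2..k + 1}" for i
  proof (cases "i = k + 1")
    case True
    then show ?thesis using assms(15,16) last by (simp add: C_def)
  next
    case False
    then show ?thesis using that assms(13,14) by (simp add: C_def)
  qed
  have "iter_exp M X (k + 1) (P (k + 1))
      = (\<integral>x. P 1 x \<partial>law_upto M X 1) + (\<Sum>i=2..k + 1. iter_exp M X (i - 1)
          (\<lambda>x. real_cond_exp M (sigma_upto M X (i - 1)) (P i) x - P (i - 1) x))"
  proof (rule conjunct2[OF iter_exp_telescope])
    show "integrable (law_upto M X 1) (P 1)"
      using assms(12) by (simp add: cov_exists_def P_def)
    fix i assume i: "i \<in> {2..k + 1}"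
    show "cond_exp_exists M (sigma_upto M X (i - 1)) (P i)"
      using C_exists[OF i] by (simp add: cond_cov_exists_def P_def F_def)
    show "iter_exp_exists M X (i - 1)
        (\<lambda>x. real_cond_exp M (sigma_upto M X (i - 1)) (P i) x - P (i - 1) x)"
      using C_exists[OF i] C_eq[OF i] by simp
  qed (auto simp: P_def intro: sub)
  also have "(\<Sum>i=2..k + 1. iter_exp M X (i - 1)
          (\<lambda>x. real_cond_exp M (sigma_upto M X (i - 1)) (P i) x - P (i - 1) x))
      = (\<Sum>i=2..k + 1. iter_exp M X (i - 1) (C i))"
    by (intro sum.cong refl) (simp only: C_eq)
  also have "\<dots> = (\<Sum>i=2..k. iter_exp M X (i - 1) (C i)) + iter_exp M X k (cond_cov M (F k) Y1 Y2)"
    using \<open>k \<ge> 1\<close> last by (simp add: C_def)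
  finally have telescoped: "iter_exp M X (k + 1) (P (k + 1)) = (\<integral>x. P 1 x \<partial>law_upto M X 1)
      + ((\<Sum>i=2..k. iter_exp M X (i - 1) (C i)) + iter_exp M X k (cond_cov M (F k) Y1 Y2))" .
  have total: "iter_exp M X (k + 1) (P (k + 1)) = (\<integral>x. Y1 x * Y2 x \<partial>M)"
    using iter_exp_eq_expectation[OF sub _ int(3)] \<open>k \<ge> 1\<close> last by (simp add: P_def)
  have means: "(\<integral>x. M1 1 x \<partial>law_upto M X 1) = (\<integral>x. Y1 x \<partial>M)"
    "(\<integral>x. M2 1 x \<partial>law_upto M X 1) = (\<integral>x. Y2 x \<partial>M)"
    using iter_exp_eq_expectation[OF sub _ int(1)] iter_exp_eq_expectation[OF sub _ int(2)] \<open>k \<ge> 1\<close>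
    by (simp_all add: M1_def M2_def iter_exp_def)
  have "prob_space (law_upto M X 1)"
    unfolding law_upto_def using subalg[of 1] \<open>k \<ge> 1\<close> assms(4)
    by (intro prob_space_restr_to_subalg) (auto simp: F_def)
  then have "cov (law_upto M X 1) (M1 1) (M2 1)
      = (\<integral>x. P 1 x \<partial>law_upto M X 1) - (\<integral>x. Y1 x \<partial>M) * (\<integral>x. Y2 x \<partial>M)"
    using cov_eq[OF _ assms(12)] means by (simp add: P_def)
  moreover have "cov M Y1 Y2 = (\<integral>x. Y1 x * Y2 x \<partial>M) - (\<integral>x. Y1 x \<partial>M) * (\<integral>x. Y2 x \<partial>M)"
    using assms(4,9) by (rule cov_eq)
  ultimately show ?thesis
    using telescoped total by (simp add: C_def)
qed

end
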